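(* Let $k,d,d'$ be integers with either $2\leq k<d\leq d'$ or $2\leq k=d<d'$. Then the following special unextendible entangled bases with Schmidt number $k$ (SUEB$k$s) exist in $\mathbb{C}^{d}\otimes\mathbb{C}^{d'}$: (1) If $k\mid d$, then for every $i\in\{1,\dots,k-1\}$ with $d'-i\geq k$, there is a $d(d'-i)$-number SUEB$k$. (2) If $k\nmid d$, write $d=sk+r$ with $0<r<k$; then for every $t\in\{0,1,\dots,k-r-1\}$ with $d'-t\geq k$, there is an $sk(d'-t)$-number SUEB$k$. (3) If $k\mid d'$, then for every $i\in\{1,\dots,k-1\}$ with $d-i\geq k$, there is a $d'(d-i)$-number SUEB$k$. (4) If $k\nmid d'$, write $d'=sk+r$ with $0<r<k$; then for every $t\in\{0,1,\dots,k-r-1\}$ with $d-t\geq k$, there is an $sk(d-t)$-number SUEB$k$.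
   Context: A pure state $|\psi\rangle\in\mathbb{C}^{d}\otimes\mathbb{C}^{d'}$ is a special entangled state with Schmidt number $k$ if its Schmidt decomposition is $|\psi\rangle=\sum_{i=0}^{k-1}\frac{1}{\sqrt{k}}|i\rangle|i'\rangle$ with $\{|i\rangle\}$, $\{|i'\rangle\}$ orthonormal sets in $\mathbb{C}^d$, $\mathbb{C}^{d'}$ respectively (i.e. Schmidt rank $k$ and all nonzero Schmidt coefficients equal to $1/\sqrt{k}$). A set $\{|\psi_i\rangle: i=1,\dots,n\}$ with $n<dd'$ of special entangled states with Schmidt number $k$ in $\mathbb{C}^{d}\otimes\mathbb{C}^{d'}$ is an $n$-number SUEB$k$ if (i) $\langle\psi_i|\psi_j\rangle=\delta_{ij}$, and (ii) any state $|\phi\rangle$ with $\langle\psi_i|\phi\rangle=0$ for all $i$ is not a special entangled state with Schmidt number $k$. *)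

theory Defs
  imports Complex_Main "Jordan_Normal_Form.Matrix" "Jordan_Normal_Form.Conjugate"
begin

text \<open>
  \<open>\<complex>\<^sup>d \<otimes> \<complex>\<^sup>e\<close> is identified with \<open>\<complex>\<^sup>d\<^sup>e\<close> through the basis
  \<open>|i\<rangle>|j\<rangle> \<mapsto> |i e + j\<rangle>\<close> (Kronecker product).
\<close>

definition tensor_vec :: "complex vec \<Rightarrow> complex vec \<Rightarrow> complex vec" where
  "tensor_vec u v = vec (dim_vec u * dim_vec v)
     (\<lambda>x. u $ (x div dim_vec v) * v $ (x mod dim_vec v))"

text \<open>The physics bracket \<open>\<langle>u|v\<rangle>\<close> is antilinear in its first argument, whereas
  \<open>\<bullet>c\<close> is antilinear in its second one.\<close>

definition braket :: "complex vec \<Rightarrow> complex vec \<Rightarrow> complex" where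
  "braket u v = v \<bullet>c u"

definition orthonormal_family :: "nat \<Rightarrow> nat set \<Rightarrow> (nat \<Rightarrow> complex vec) \<Rightarrow> bool" where
  "orthonormal_family n I u \<longleftrightarrow>
     (\<forall>i\<in>I. u i \<in> carrier_vec n) \<and>
     (\<forall>i\<in>I. \<forall>j\<in>I. braket (u i) (u j) = (if i = j then 1 else 0))"

definition pure_state :: "nat \<Rightarrow> complex vec \<Rightarrow> bool" where
  "pure_state n \<phi> \<longleftrightarrow> \<phi> \<in> carrier_vec n \<and> braket \<phi> \<phi> = 1"

definition special_entangled :: "nat \<Rightarrow> nat \<Rightarrow> nat \<Rightarrow> complex vec \<Rightarrow> bool" where
  "special_entangled d d' k \<psi> \<longleftrightarrow>
     pure_state (d * d') \<psi> \<and>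
     (\<exists>u v. orthonormal_family d {0..<k} u \<and> orthonormal_family d' {0..<k} v \<and>
        \<psi> = finsum_vec TYPE(complex) (d * d')
              (\<lambda>i. complex_of_real (1 / sqrt (real k)) \<cdot>\<^sub>v tensor_vec (u i) (v i)) {0..<k})"

definition SUEB :: "nat \<Rightarrow> nat \<Rightarrow> nat \<Rightarrow> nat \<Rightarrow> (nat \<Rightarrow> complex vec) \<Rightarrow> bool" where
  "SUEB d d' k n \<psi> \<longleftrightarrow>
     n < d * d' \<and>
     (\<forall>i\<in>{1..n}. special_entangled d d' k (\<psi> i)) \<and>
     (\<forall>i\<in>{1..n}. \<forall>j\<in>{1..n}. braket (\<psi> i) (\<psi> j) = (if i = j then 1 else 0)) \<and>
     (\<forall>\<phi>. pure_state (d * d') \<phi> \<and> (\<forall>i\<in>{1..n}. braket (\<psi> i) \<phi> = 0) \<longrightarrow>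
        \<not> special_entangled d d' k \<phi>)"

end

theory Submission
  imports Defs "HOL-Number_Theory.Cong"
begin

text \<open>
  Read a state in \<open>\<complex>\<^sup>d \<otimes> \<complex>\<^sup>e\<close> as its \<open>d \<times> e\<close> matrix of coordinates. For \<open>s k \<le> d\<close> and
  \<open>k \<le> q \<le> e\<close> the states
  \<open>(1/\<surd>k) \<Sum>\<^sub>l \<omega>\<^sup>m\<^sup>l |a k + l\<rangle> |(l + j) mod q\<rangle>\<close>, with \<open>\<omega>\<close> a primitive \<open>k\<close>-th root of unity,
  \<open>a < s\<close>, \<open>m < k\<close> and \<open>j < q\<close>, form an orthonormal basis of the matrices supported on the first
  \<open>s k\<close> rows and first \<open>q\<close> columns. A matrix orthogonal to all of them therefore lives on the
  other \<open>d - s k\<close> rows and \<open>e - q\<close> columns. If it came from a special entangled state, each row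
  and each column would have squared norm at most \<open>1/k\<close> by Bessel's inequality, while its total
  squared norm is \<open>1\<close>; hence \<open>k \<le> (d - s k) + (e - q)\<close>, which fails in each of the four cases
  (the last two being the first two with the tensor factors exchanged).
\<close>

subsection \<open>Coordinates in a tensor product\<close>

lemma pair_index_less:
  fixes x y d e :: nat
  assumes "x < d" "y < e"
  shows "x * e + y < d * e"
proof -
  have "x * e + y < Suc x * e"
    using assms by simp
  also have "\<dots> \<le> d * e"
    using assms by (intro mult_right_mono) auto
  finally show ?thesis .
qed

lemma pair_index_eq_iff:
  fixes x x' y y' e :: nat
  assumes "y < e" "y' < e"
  shows "x * e + y = x' * e + y' \<longleftrightarrow> x = x' \<and> y = y'"
proof
  assume "x * e + y = x' * e + y'"
  then have "(x * e + y) div e = (x' * e + y') div e" "(x * e + y) mod e = (x' * e + y') mod e"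
    by simp_all
  then show "x = x' \<and> y = y'"
    using assms by simp
qed simp

lemma sum_lessThan_mult:
  fixes f :: "nat \<Rightarrow> 'a::comm_monoid_add"
  shows "(\<Sum>z<d * e. f z) = (\<Sum>x<d. \<Sum>y<e. f (x * e + y))"
proof -
  have "sum f {x * e..<x * e + e} = (\<Sum>y<e. f (x * e + y))" for x
    using sum.shift_bounds_nat_ivl[of f 0 "x * e" e]
    by (simp add: atLeast0LessThan add.commute)
  then show ?thesis
    by (simp flip: sum.nat_group)
qed

lemma eq_vec_pairI:
  assumes "u \<in> carrier_vec (d * e)" "v \<in> carrier_vec (d * e)"
    and "\<And>x y. x < d \<Longrightarrow> y < e \<Longrightarrow> u $ (x * e + y) = v $ (x * e + y)"
  shows "u = v"
proof (rule eq_vecI)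
  fix z assume "z < dim_vec v"
  then have "z div e < d" "z mod e < e"
    using assms(2) by (auto simp: less_mult_imp_div_less intro!: mod_less_divisor gr0I)
  from assms(3)[OF this] show "u $ z = v $ z"
    by simp
qed (use assms in simp)

lemma tensor_vec_carrier:
  "u \<in> carrier_vec d \<Longrightarrow> v \<in> carrier_vec e \<Longrightarrow> tensor_vec u v \<in> carrier_vec (d * e)"
  by (auto simp: tensor_vec_def)

lemma index_tensor_vec:
  assumes "u \<in> carrier_vec d" "v \<in> carrier_vec e" "x < d" "y < e"
  shows "tensor_vec u v $ (x * e + y) = u $ x * v $ y"
  using assms pair_index_less[OF assms(3,4)] by (auto simp: tensor_vec_def)

lemma tensor_vec_smult_unit_vec:
  assumes "x < d" "y < e"
  shows "tensor_vec (c \<cdot>\<^sub>v unit_vec d x) (unit_vec e y) = c \<cdot>\<^sub>v unit_vec (d * e) (x * e + y)"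
  using assms
  by (intro eq_vec_pairI[of _ d e])
    (auto simp: tensor_vec_carrier index_tensor_vec[of _ d _ e] pair_index_less pair_index_eq_iff)

subsection \<open>Brackets\<close>

lemma braket_eq_sum:
  "u \<in> carrier_vec n \<Longrightarrow> braket u v = (\<Sum>z<n. cnj (u $ z) * v $ z)"
  by (auto simp: braket_def scalar_prod_def atLeast0LessThan mult.commute intro!: sum.cong)

lemma braket_eq_sum_sum:
  "u \<in> carrier_vec (d * e) \<Longrightarrow>
    braket u v = (\<Sum>x<d. \<Sum>y<e. cnj (u $ (x * e + y)) * v $ (x * e + y))"
  by (simp add: braket_eq_sum sum_lessThan_mult)

lemma cnj_braket:
  assumes "u \<in> carrier_vec n" "v \<in> carrier_vec n"
  shows "cnj (braket u v) = braket v u"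
  using assms by (simp add: braket_eq_sum mult.commute)

lemma braket_smult_unit_vec:
  assumes "x < n" "v \<in> carrier_vec n"
  shows "braket (c \<cdot>\<^sub>v unit_vec n x) v = cnj c * v $ x"
proof -
  have "braket (c \<cdot>\<^sub>v unit_vec n x) v = (\<Sum>z<n. if z = x then cnj c * v $ x else 0)"
    unfolding braket_eq_sum[OF smult_carrier_vec[THEN iffD2, OF unit_vec_carrier]]
    using assms by (intro sum.cong) auto
  then show ?thesis
    using assms by simp
qed

lemma braket_tensor_vec:
  assumes "u \<in> carrier_vec d" "v \<in> carrier_vec e" "u' \<in> carrier_vec d" "v' \<in> carrier_vec e"
  shows "braket (tensor_vec u v) (tensor_vec u' v') = braket u u' * braket v v'"
proof -
  have "braket (tensor_vec u v) (tensor_vec u' v') =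
      (\<Sum>x<d. \<Sum>y<e. (cnj (u $ x) * u' $ x) * (cnj (v $ y) * v' $ y))"
    using assms
    by (simp add: braket_eq_sum_sum[of _ d e] tensor_vec_carrier index_tensor_vec mult_ac)
  also have "\<dots> = braket u u' * braket v v'"
    using assms by (simp add: braket_eq_sum[of _ d] braket_eq_sum[of _ e] sum_product)
  finally show ?thesis .
qed

lemma pure_state_sum_norm:
  assumes "pure_state (d * e) \<phi>"
  shows "(\<Sum>x<d. \<Sum>y<e. (cmod (\<phi> $ (x * e + y)))\<^sup>2) = 1"
proof -
  have "complex_of_real (\<Sum>x<d. \<Sum>y<e. (cmod (\<phi> $ (x * e + y)))\<^sup>2) = braket \<phi> \<phi>"
    using assms unfolding pure_state_def
    by (subst braket_eq_sum_sum[of \<phi> d e])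
      (simp_all add: complex_norm_square mult.commute del: of_real_power)
  then show ?thesis
    using assms by (simp add: pure_state_def del: of_real_sum of_real_power)
qed

subsection \<open>Orthonormal families\<close>

lemma orthonormal_family_carrier:
  "orthonormal_family n I u \<Longrightarrow> i \<in> I \<Longrightarrow> u i \<in> carrier_vec n"
  by (simp add: orthonormal_family_def)

lemma sum_norm_orthonormal_combination:
  assumes "orthonormal_family n I v" "finite I"
  shows "(\<Sum>y<n. (cmod (\<Sum>l\<in>I. a l * v l $ y))\<^sup>2) = (\<Sum>l\<in>I. (cmod (a l))\<^sup>2)"
proof -
  have "complex_of_real (\<Sum>y<n. (cmod (\<Sum>l\<in>I. a l * v l $ y))\<^sup>2) =
      (\<Sum>y<n. \<Sum>l\<in>I. \<Sum>m\<in>I. a l * cnj (a m) * (cnj (v m $ y) * v l $ y))"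
    by (simp add: complex_norm_square sum_product mult_ac del: of_real_power)
  also have "\<dots> = (\<Sum>l\<in>I. \<Sum>m\<in>I. a l * cnj (a m) * braket (v m) (v l))"
    using assms(1)
    by (simp add: braket_eq_sum[OF orthonormal_family_carrier] sum_distrib_left
        sum.swap[of _ _ "{..<n}"])
  also have "\<dots> = (\<Sum>l\<in>I. \<Sum>m\<in>I. if m = l then a l * cnj (a l) else 0)"
    using assms(1) by (intro sum.cong) (auto simp: orthonormal_family_def)
  also have "\<dots> = complex_of_real (\<Sum>l\<in>I. (cmod (a l))\<^sup>2)"
    using assms(2) by (simp add: complex_norm_square del: of_real_power)
  finally show ?thesis
    by (simp only: of_real_eq_iff)
qed

lemma orthonormal_family_bessel_coordinate:
  assumes "orthonormal_family n I u" "finite I" "x < n"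
  shows "(\<Sum>l\<in>I. (cmod (u l $ x))\<^sup>2) \<le> 1"
proof -
  \<comment> \<open>The projection of the \<open>x\<close>-th basis vector onto the span has \<open>t\<close> both as its \<open>x\<close>-th
    coordinate and as its squared norm.\<close>
  define t where "t = (\<Sum>l\<in>I. (cmod (u l $ x))\<^sup>2)"
  have "(\<Sum>l\<in>I. cnj (u l $ x) * u l $ x) = complex_of_real t"
    by (simp add: t_def complex_norm_square mult.commute del: of_real_power)
  then have "t\<^sup>2 = (cmod (\<Sum>l\<in>I. cnj (u l $ x) * u l $ x))\<^sup>2"
    by simp
  also have "\<dots> \<le> (\<Sum>y<n. (cmod (\<Sum>l\<in>I. cnj (u l $ x) * u l $ y))\<^sup>2)"
    using \<open>x < n\<close> by (intro member_le_sum) auto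
  also have "\<dots> = t"
    using sum_norm_orthonormal_combination[OF assms(1,2)] by (simp add: t_def)
  finally have "t * t \<le> t * 1"
    by (simp add: power2_eq_square)
  then have "t \<le> 1"
    by (cases "t > 0") auto
  then show ?thesis
    by (simp add: t_def)
qed

subsection \<open>States with equal Schmidt coefficients\<close>

definition uniform_schmidt_state ::
  "nat \<Rightarrow> nat \<Rightarrow> nat \<Rightarrow> (nat \<Rightarrow> complex vec) \<Rightarrow> (nat \<Rightarrow> complex vec) \<Rightarrow> complex vec" where
  "uniform_schmidt_state d e k u v = finsum_vec TYPE(complex) (d * e)
     (\<lambda>l. complex_of_real (1 / sqrt (real k)) \<cdot>\<^sub>v tensor_vec (u l) (v l)) {0..<k}"

lemma special_entangled_iff:
  "special_entangled d e k \<phi> \<longleftrightarrow> pure_state (d * e) \<phi> \<and>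
     (\<exists>u v. orthonormal_family d {0..<k} u \<and> orthonormal_family e {0..<k} v \<and>
        \<phi> = uniform_schmidt_state d e k u v)"
  unfolding special_entangled_def uniform_schmidt_state_def ..

context
  fixes d e k :: nat and u v :: "nat \<Rightarrow> complex vec"
  assumes u: "\<And>l. l < k \<Longrightarrow> u l \<in> carrier_vec d" and v: "\<And>l. l < k \<Longrightarrow> v l \<in> carrier_vec e"
begin

lemma uniform_schmidt_state_carrier: "uniform_schmidt_state d e k u v \<in> carrier_vec (d * e)"
  unfolding uniform_schmidt_state_def
  by (intro finsum_vec_closed) (auto simp: u v tensor_vec_carrier)

lemma index_uniform_schmidt_state:
  assumes "z < d * e"
  shows "uniform_schmidt_state d e k u v $ z =
    complex_of_real (1 / sqrt (real k)) * (\<Sum>l<k. tensor_vec (u l) (v l) $ z)"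
proof -
  let ?c = "complex_of_real (1 / sqrt (real k))"
  have dim: "dim_vec (tensor_vec (u l) (v l)) = d * e" if "l < k" for l
    using that by (intro carrier_vecD tensor_vec_carrier u v)
  have "uniform_schmidt_state d e k u v $ z = (\<Sum>l\<in>{0..<k}. (?c \<cdot>\<^sub>v tensor_vec (u l) (v l)) $ z)"
    unfolding uniform_schmidt_state_def
    by (intro index_finsum_vec assms) (auto simp: u v tensor_vec_carrier)
  then show ?thesis
    using assms by (simp add: dim sum_distrib_left atLeast0LessThan)
qed

lemma index_pair_uniform_schmidt_state:
  assumes "x < d" "y < e"
  shows "uniform_schmidt_state d e k u v $ (x * e + y) =
    complex_of_real (1 / sqrt (real k)) * (\<Sum>l<k. u l $ x * v l $ y)"
  using assms
  by (simp add: index_uniform_schmidt_state pair_index_less u v index_tensor_vec[of _ d _ e])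

lemma braket_uniform_schmidt_state:
  "braket (uniform_schmidt_state d e k u v) \<phi> =
    complex_of_real (1 / sqrt (real k)) * (\<Sum>l<k. braket (tensor_vec (u l) (v l)) \<phi>)"
proof -
  let ?c = "complex_of_real (1 / sqrt (real k))"
  have "braket (uniform_schmidt_state d e k u v) \<phi> =
      (\<Sum>z<d * e. \<Sum>l<k. ?c * (cnj (tensor_vec (u l) (v l) $ z) * \<phi> $ z))"
    by (simp add: braket_eq_sum[OF uniform_schmidt_state_carrier] index_uniform_schmidt_state
        sum_distrib_left sum_distrib_right mult_ac)
  also have "\<dots> = ?c * (\<Sum>l<k. braket (tensor_vec (u l) (v l)) \<phi>)"
    by (subst sum.swap) (simp add: braket_eq_sum[OF tensor_vec_carrier[OF u v]] sum_distrib_left)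
  finally show ?thesis .
qed

end

lemma braket_uniform_schmidt_states:
  assumes "\<And>l. l < k \<Longrightarrow> u l \<in> carrier_vec d" "\<And>l. l < k \<Longrightarrow> v l \<in> carrier_vec e"
    and "\<And>l. l < k \<Longrightarrow> u' l \<in> carrier_vec d" "\<And>l. l < k \<Longrightarrow> v' l \<in> carrier_vec e"
  shows "braket (uniform_schmidt_state d e k u v) (uniform_schmidt_state d e k u' v') =
    (\<Sum>l<k. \<Sum>m<k. braket (u l) (u' m) * braket (v l) (v' m)) / of_nat k"
proof -
  let ?c = "complex_of_real (1 / sqrt (real k))"
  have "braket (tensor_vec (u l) (v l)) (uniform_schmidt_state d e k u' v') =
      ?c * (\<Sum>m<k. braket (u l) (u' m) * braket (v l) (v' m))" if "l < k" for l
  proof -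
    have "braket (tensor_vec (u l) (v l)) (uniform_schmidt_state d e k u' v') =
        cnj (braket (uniform_schmidt_state d e k u' v') (tensor_vec (u l) (v l)))"
      using assms that
      by (intro cnj_braket[symmetric, of _ "d * e"])
        (auto intro: uniform_schmidt_state_carrier tensor_vec_carrier)
    then show ?thesis
      using assms that
      by (simp add: braket_uniform_schmidt_state braket_tensor_vec[of _ d _ e]
          cnj_braket[of _ d] cnj_braket[of _ e])
  qed
  then have "braket (uniform_schmidt_state d e k u v) (uniform_schmidt_state d e k u' v') =
      (?c * ?c) * (\<Sum>l<k. \<Sum>m<k. braket (u l) (u' m) * braket (v l) (v' m))"
    using assms by (simp add: braket_uniform_schmidt_state sum_distrib_left)
  also have "?c * ?c = 1 / of_nat k"
    by (simp flip: of_real_mult)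
  finally show ?thesis
    by simp
qed

lemma special_entangled_uniform_schmidt_state:
  assumes "orthonormal_family d {0..<k} u" "orthonormal_family e {0..<k} v" "0 < k"
  shows "special_entangled d e k (uniform_schmidt_state d e k u v)"
proof -
  have u: "u l \<in> carrier_vec d" and v: "v l \<in> carrier_vec e" if "l < k" for l
    using assms orthonormal_family_carrier that by auto
  have "(\<Sum>l<k. \<Sum>m<k. braket (u l) (u m) * braket (v l) (v m)) =
      (\<Sum>l<k. \<Sum>m<k. if l = m then 1 else 0)"
    using assms by (intro sum.cong) (auto simp: orthonormal_family_def)
  then have "braket (uniform_schmidt_state d e k u v) (uniform_schmidt_state d e k u v) = 1"
    using \<open>0 < k\<close> by (simp add: braket_uniform_schmidt_states u v)
  then show ?thesis
    using assms u v unfolding special_entangled_iff pure_state_def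
    by (blast intro: uniform_schmidt_state_carrier)
qed

subsection \<open>Exchanging the tensor factors\<close>

definition swap_vec :: "nat \<Rightarrow> nat \<Rightarrow> complex vec \<Rightarrow> complex vec" where
  "swap_vec d e \<phi> = vec (e * d) (\<lambda>z. \<phi> $ (z mod d * e + z div d))"

lemma swap_vec_carrier: "swap_vec d e \<phi> \<in> carrier_vec (e * d)"
  by (simp add: swap_vec_def)

lemma index_swap_vec:
  "x < d \<Longrightarrow> y < e \<Longrightarrow> swap_vec d e \<phi> $ (y * d + x) = \<phi> $ (x * e + y)"
  by (simp add: swap_vec_def pair_index_less)

lemma braket_swap_vec:
  assumes "\<psi> \<in> carrier_vec (d * e)"
  shows "braket (swap_vec d e \<psi>) \<phi> = braket \<psi> (swap_vec e d \<phi>)"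
proof -
  have "braket (swap_vec d e \<psi>) \<phi> = (\<Sum>y<e. \<Sum>x<d. cnj (\<psi> $ (x * e + y)) * \<phi> $ (y * d + x))"
    by (simp add: braket_eq_sum_sum[OF swap_vec_carrier] index_swap_vec)
  also have "\<dots> = (\<Sum>x<d. \<Sum>y<e. cnj (\<psi> $ (x * e + y)) * \<phi> $ (y * d + x))"
    by (rule sum.swap)
  also have "\<dots> = braket \<psi> (swap_vec e d \<phi>)"
    using assms by (simp add: braket_eq_sum_sum index_swap_vec)
  finally show ?thesis .
qed

lemma swap_vec_swap_vec:
  assumes "\<phi> \<in> carrier_vec (d * e)"
  shows "swap_vec e d (swap_vec d e \<phi>) = \<phi>"
  using assms by (intro eq_vec_pairI[of _ d e]) (auto simp: swap_vec_carrier index_swap_vec)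

lemma swap_vec_uniform_schmidt_state:
  assumes "\<And>l. l < k \<Longrightarrow> u l \<in> carrier_vec d" "\<And>l. l < k \<Longrightarrow> v l \<in> carrier_vec e"
  shows "swap_vec d e (uniform_schmidt_state d e k u v) = uniform_schmidt_state e d k v u"
  using assms
  by (intro eq_vec_pairI[of _ e d] swap_vec_carrier uniform_schmidt_state_carrier)
    (simp_all add: index_swap_vec index_pair_uniform_schmidt_state mult.commute)

lemma special_entangled_swap_vec:
  assumes "special_entangled d e k \<phi>"
  shows "special_entangled e d k (swap_vec d e \<phi>)"
proof -
  obtain u v where uv: "orthonormal_family d {0..<k} u" "orthonormal_family e {0..<k} v"
    and \<phi>: "pure_state (d * e) \<phi>" "\<phi> = uniform_schmidt_state d e k u v"
    using assms by (auto simp: special_entangled_iff)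
  have "swap_vec d e \<phi> = uniform_schmidt_state e d k v u"
    unfolding \<phi>(2) using uv
    by (intro swap_vec_uniform_schmidt_state) (auto intro: orthonormal_family_carrier)
  moreover have "pure_state (e * d) (swap_vec d e \<phi>)"
    using \<phi>(1) by (simp add: pure_state_def swap_vec_carrier braket_swap_vec swap_vec_swap_vec)
  ultimately show ?thesis
    using uv by (auto simp: special_entangled_iff)
qed

lemma SUEB_swap_vec:
  assumes "SUEB d e k n \<psi>"
  shows "SUEB e d k n (\<lambda>i. swap_vec d e (\<psi> i))"
proof -
  have carrier: "\<psi> i \<in> carrier_vec (d * e)" if "i \<in> {1..n}" for i
    using assms that by (auto simp: SUEB_def special_entangled_def pure_state_def)
  have "\<not> special_entangled e d k \<phi>" if "\<forall>i\<in>{1..n}. braket (swap_vec d e (\<psi> i)) \<phi> = 0" for \<phi>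
  proof
    assume "special_entangled e d k \<phi>"
    then have special: "special_entangled d e k (swap_vec e d \<phi>)"
      by (rule special_entangled_swap_vec)
    have "\<forall>i\<in>{1..n}. braket (\<psi> i) (swap_vec e d \<phi>) = 0"
      using that carrier by (simp add: braket_swap_vec)
    then show False
      using assms special by (auto simp: SUEB_def special_entangled_def)
  qed
  then show ?thesis
    using assms carrier special_entangled_swap_vec
    by (simp add: SUEB_def braket_swap_vec swap_vec_swap_vec mult.commute)
qed

subsection \<open>The zero block of a special entangled state\<close>

lemma special_entangled_row_norm_le:
  assumes "special_entangled d e k \<phi>" "x < d"
  shows "(\<Sum>y<e. (cmod (\<phi> $ (x * e + y)))\<^sup>2) \<le> 1 / real k"
proof -
  obtain u v where u: "orthonormal_family d {0..<k} u" and v: "orthonormal_family e {0..<k} v"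
    and \<phi>: "\<phi> = uniform_schmidt_state d e k u v"
    using assms by (auto simp: special_entangled_iff)
  have "\<phi> $ (x * e + y) = complex_of_real (1 / sqrt (real k)) * (\<Sum>l<k. u l $ x * v l $ y)"
    if "y < e" for y
    unfolding \<phi> using u v \<open>x < d\<close> that
    by (intro index_pair_uniform_schmidt_state) (auto intro: orthonormal_family_carrier)
  then have "(\<Sum>y<e. (cmod (\<phi> $ (x * e + y)))\<^sup>2) =
      (\<Sum>y<e. (cmod (\<Sum>l\<in>{0..<k}. u l $ x * v l $ y))\<^sup>2) / real k"
    by (simp add: norm_divide power_divide atLeast0LessThan flip: sum_divide_distrib)
  also have "\<dots> = (\<Sum>l\<in>{0..<k}. (cmod (u l $ x))\<^sup>2) / real k"
    by (simp only: sum_norm_orthonormal_combination[OF v finite_atLeastLessThan])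
  also have "\<dots> \<le> 1 / real k"
    using orthonormal_family_bessel_coordinate[OF u _ \<open>x < d\<close>] by (simp add: divide_right_mono)
  finally show ?thesis .
qed

lemma special_entangled_column_norm_le:
  assumes "special_entangled d e k \<phi>" "y < e"
  shows "(\<Sum>x<d. (cmod (\<phi> $ (x * e + y)))\<^sup>2) \<le> 1 / real k"
  using special_entangled_row_norm_le[OF special_entangled_swap_vec[OF assms(1)] assms(2)]
  by (simp add: index_swap_vec assms(2))

lemma special_entangled_zero_block:
  assumes special: "special_entangled d e k \<phi>" and "p \<le> d" "q \<le> e"
    and zero: "\<And>x y. x < p \<Longrightarrow> y < q \<Longrightarrow> \<phi> $ (x * e + y) = 0"
  shows "k \<le> (d - p) + (e - q)"
proof (cases "k = 0")
  case False
  define w where "w x y = (cmod (\<phi> $ (x * e + y)))\<^sup>2" for x y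
  have "1 = (\<Sum>x<d. \<Sum>y<e. w x y)"
    using special pure_state_sum_norm by (simp add: special_entangled_def w_def)
  also have "\<dots> = (\<Sum>x<p. \<Sum>y<e. w x y) + (\<Sum>x=p..<d. \<Sum>y<e. w x y)"
    using \<open>p \<le> d\<close> sum.atLeastLessThan_concat[of 0 p d "\<lambda>x. \<Sum>y<e. w x y"]
    by (simp add: atLeast0LessThan)
  also have "(\<Sum>x<p. \<Sum>y<e. w x y) = (\<Sum>x<p. \<Sum>y=q..<e. w x y)"
    using zero \<open>q \<le> e\<close> by (intro sum.cong sum.mono_neutral_right) (auto simp: w_def)
  also have "\<dots> = (\<Sum>y=q..<e. \<Sum>x<p. w x y)"
    by (rule sum.swap)
  also have "\<dots> \<le> (\<Sum>y=q..<e. \<Sum>x<d. w x y)"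
    using \<open>p \<le> d\<close> by (intro sum_mono sum_mono2) (auto simp: w_def)
  also have "\<dots> \<le> (\<Sum>y=q..<e. 1 / real k)"
    using special_entangled_column_norm_le[OF special] by (intro sum_mono) (auto simp: w_def)
  also have "(\<Sum>x=p..<d. \<Sum>y<e. w x y) \<le> (\<Sum>x=p..<d. 1 / real k)"
    using special_entangled_row_norm_le[OF special] by (intro sum_mono) (auto simp: w_def)
  finally have "1 \<le> (real (d - p) + real (e - q)) / real k"
    by (simp add: add_divide_distrib)
  then have "real k \<le> real ((d - p) + (e - q))"
    using False by (simp add: field_simps)
  then show ?thesis
    by (simp only: of_nat_le_iff)
qed simp

subsection \<open>The discrete Fourier basis of a block\<close>

definition unity_root :: "nat \<Rightarrow> complex" where
  "unity_root k = cis (2 * pi / real k)"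

lemma unity_root_power: "unity_root k ^ n = cis (2 * pi * real n / real k)"
  by (simp add: unity_root_def DeMoivre mult_ac)

lemma inj_on_unity_root_power: "0 < k \<Longrightarrow> inj_on (\<lambda>n. unity_root k ^ n) {..<k}"
  using bij_betw_roots_unity[of k] by (simp add: unity_root_power bij_betw_def)

lemma sum_unity_root_orthogonal:
  assumes "a < k" "b < k"
  shows "(\<Sum>l<k. cnj (unity_root k ^ (a * l)) * unity_root k ^ (b * l)) =
    (if a = b then of_nat k else 0)"
proof -
  define z where "z = unity_root k ^ b / unity_root k ^ a"
  have nonzero: "unity_root k \<noteq> 0"
    by (simp add: unity_root_def)
  have "cnj (unity_root k ^ n) = inverse (unity_root k ^ n)" for n
    by (simp only: unity_root_power cis_cnj cis_inverse)
  then have geometric: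
    "(\<Sum>l<k. cnj (unity_root k ^ (a * l)) * unity_root k ^ (b * l)) = (\<Sum>l<k. z ^ l)"
    by (simp add: z_def power_divide inverse_eq_divide mult.commute flip: power_mult)
  show ?thesis
  proof (cases "a = b")
    case True
    then have "z = 1"
      by (simp add: z_def nonzero)
    then show ?thesis
      unfolding geometric using True by simp
  next
    case False
    then have "z \<noteq> 1"
      using inj_onD[OF inj_on_unity_root_power, of k b a] assms nonzero by (auto simp: z_def)
    moreover have "z ^ k = 1"
    proof -
      have "unity_root k ^ k = 1"
        using assms by (simp add: unity_root_power)
      then have "(unity_root k ^ n) ^ k = 1" for n
        by (metis power_mult mult.commute power_one)
      then show ?thesis
        by (simp add: z_def power_divide)
    qed
    ultimately show ?thesis
      unfolding geometric using False by (simp add: geometric_sum)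
  qed
qed

lemma bij_betw_add_mod: "bij_betw (\<lambda>j. (l + j) mod q) {..<q} {..<q}" for l q :: nat
proof -
  have "inj_on (\<lambda>j. (l + j) mod q) {..<q}"
    by (auto simp: inj_on_def cong_add_lcancel_nat simp flip: cong_def
        intro: cong_less_modulus_unique_nat)
  moreover have "(\<lambda>j. (l + j) mod q) ` {..<q} \<subseteq> {..<q}"
    by auto
  ultimately show ?thesis
    by (simp add: bij_betw_def endo_inj_surj)
qed

lemma add_mod_left_eq_iff:
  fixes l i j q :: nat
  assumes "i < q" "j < q"
  shows "(l + i) mod q = (l + j) mod q \<longleftrightarrow> i = j"
  using inj_on_eq_iff[OF bij_betw_imp_inj_on[OF bij_betw_add_mod]] assms by simp

locale fourier_block =
  fixes d e k s q :: nat
  assumes k_pos: "0 < k" and rows_le: "s * k \<le> d" and k_le_columns: "k \<le> q" and columns_le: "q \<le> e"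
begin

definition row_vec :: "nat \<Rightarrow> nat \<Rightarrow> nat \<Rightarrow> complex vec" where
  "row_vec a m l = unity_root k ^ (m * l) \<cdot>\<^sub>v unit_vec d (a * k + l)"

definition column_vec :: "nat \<Rightarrow> nat \<Rightarrow> complex vec" where
  "column_vec j l = unit_vec e ((l + j) mod q)"

definition fourier_state :: "nat \<times> nat \<times> nat \<Rightarrow> complex vec" where
  "fourier_state = (\<lambda>(a, m, j). uniform_schmidt_state d e k (row_vec a m) (column_vec j))"

definition fourier_index :: "(nat \<times> nat \<times> nat) set" where
  "fourier_index = {..<s} \<times> {..<k} \<times> {..<q}"

lemma row_less: "a < s \<Longrightarrow> l < k \<Longrightarrow> a * k + l < d"
  using pair_index_less rows_le by (meson less_le_trans)

lemma column_less: "(l + j) mod q < e"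
  using k_pos k_le_columns columns_le by (meson less_le_trans mod_less_divisor)

lemma row_vec_carrier: "row_vec a m l \<in> carrier_vec d"
  by (simp add: row_vec_def)

lemma column_vec_carrier: "column_vec j l \<in> carrier_vec e"
  by (simp add: column_vec_def)

lemma braket_row_vec:
  assumes "a < s" "b < s" "l < k" "l' < k"
  shows "braket (row_vec a m l) (row_vec b n l') =
    (if a = b \<and> l = l' then cnj (unity_root k ^ (m * l)) * unity_root k ^ (n * l) else 0)"
  using assms row_less[of a l] row_less[of b l'] pair_index_eq_iff[of l k l' a b]
  by (simp add: row_vec_def braket_smult_unit_vec)

lemma braket_column_vec:
  "braket (column_vec i l) (column_vec j l') = (if (l + i) mod q = (l' + j) mod q then 1 else 0)"
  using braket_smult_unit_vec[OF column_less, of "column_vec j l'" 1 l i] column_less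
  by (simp add: column_vec_def)

lemma orthonormal_row_vec: "a < s \<Longrightarrow> orthonormal_family d {0..<k} (row_vec a m)"
  by (auto simp: orthonormal_family_def row_vec_carrier braket_row_vec unity_root_power
      cis_cnj cis_mult simp del: complex_cnj_power)

lemma orthonormal_column_vec: "orthonormal_family e {0..<k} (column_vec j)"
  using k_le_columns add_mod_left_eq_iff[of _ q _ j]
  by (simp add: orthonormal_family_def column_vec_carrier braket_column_vec add.commute[of _ j])

lemma special_entangled_fourier_state:
  "i \<in> fourier_index \<Longrightarrow> special_entangled d e k (fourier_state i)"
  by (auto simp: fourier_state_def fourier_index_def k_pos
      orthonormal_row_vec orthonormal_column_vec intro!: special_entangled_uniform_schmidt_state)

lemma braket_fourier_states:
  assumes "i \<in> fourier_index" "i' \<in> fourier_index"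
  shows "braket (fourier_state i) (fourier_state i') = (if i = i' then 1 else 0)"
proof -
  obtain a m j b n j' where components: "i = (a, m, j)" "i' = (b, n, j')"
    by (metis prod_cases3)
  have less: "a < s" "m < k" "j < q" "b < s" "n < k" "j' < q"
    using assms by (simp_all add: components fourier_index_def)
  define c where "c l = cnj (unity_root k ^ (m * l)) * unity_root k ^ (n * l)" for l
  have "braket (row_vec a m l) (row_vec b n l') * braket (column_vec j l) (column_vec j' l') =
      (if l = l' then if a = b \<and> j = j' then c l else 0 else 0)" if "l < k" "l' < k" for l l'
    using less that by (auto simp: c_def braket_row_vec braket_column_vec add_mod_left_eq_iff)
  then have "braket (fourier_state i) (fourier_state i') =
      (\<Sum>l<k. if a = b \<and> j = j' then c l else 0) / of_nat k"
    by (simp add: components fourier_state_def braket_uniform_schmidt_states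
        row_vec_carrier column_vec_carrier)
  also have "\<dots> = (if a = b \<and> j = j' then \<Sum>l<k. c l else 0) / of_nat k"
    by auto
  also have "(\<Sum>l<k. c l) = (if m = n then of_nat k else 0)"
    unfolding c_def by (rule sum_unity_root_orthogonal[OF less(2,5)])
  finally show ?thesis
    using k_pos by (auto simp: components)
qed

lemma braket_fourier_state:
  assumes "a < s" "\<phi> \<in> carrier_vec (d * e)"
  shows "braket (fourier_state (a, m, j)) \<phi> = complex_of_real (1 / sqrt (real k)) *
    (\<Sum>l<k. cnj (unity_root k ^ (m * l)) * \<phi> $ ((a * k + l) * e + (l + j) mod q))"
proof -
  have "braket (tensor_vec (row_vec a m l) (column_vec j l)) \<phi> =
      cnj (unity_root k ^ (m * l)) * \<phi> $ ((a * k + l) * e + (l + j) mod q)" if "l < k" for l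
    unfolding row_vec_def column_vec_def
    using assms that row_less column_less pair_index_less
    by (simp add: tensor_vec_smult_unit_vec braket_smult_unit_vec del: complex_cnj_power)
  then show ?thesis
    by (simp add: fourier_state_def braket_uniform_schmidt_state row_vec_carrier column_vec_carrier
        del: complex_cnj_power)
qed

lemma zero_block_if_orthogonal_to_fourier_states:
  assumes "\<phi> \<in> carrier_vec (d * e)" "\<And>i. i \<in> fourier_index \<Longrightarrow> braket (fourier_state i) \<phi> = 0"
    and "x < s * k" "y < q"
  shows "\<phi> $ (x * e + y) = 0"
proof -
  define a n where "a = x div k" and "n = x mod k"
  have a_less: "a < s" and n_less: "n < k" and x_eq: "x = a * k + n"
    using k_pos \<open>x < s * k\<close> by (auto simp: a_def n_def less_mult_imp_div_less)
  obtain j where j: "j < q" "y = (n + j) mod q"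
    using bij_betw_imp_surj_on[OF bij_betw_add_mod[of n q]] \<open>y < q\<close> by auto
  define g where "g l = \<phi> $ ((a * k + l) * e + (l + j) mod q)" for l
  have "(\<Sum>l<k. cnj (unity_root k ^ (m * l)) * g l) = 0" if "m < k" for m
    using assms(2)[of "(a, m, j)"] braket_fourier_state[OF a_less assms(1), of m j]
      a_less j(1) k_pos that
    by (simp add: g_def fourier_index_def)
  then have "0 = (\<Sum>m<k. unity_root k ^ (n * m) * (\<Sum>l<k. cnj (unity_root k ^ (m * l)) * g l))"
    by simp
  also have "\<dots> = (\<Sum>l<k. (\<Sum>m<k. cnj (unity_root k ^ (l * m)) * unity_root k ^ (n * m)) * g l)"
    unfolding sum_distrib_left sum_distrib_right by (subst sum.swap) (simp add: mult_ac)
  also have "\<dots> = (\<Sum>l<k. if l = n then of_nat k * g n else 0)"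
    using n_less
    by (intro sum.cong) (auto simp: sum_unity_root_orthogonal simp del: complex_cnj_power)
  also have "\<dots> = of_nat k * g n"
    using n_less by simp
  finally show ?thesis
    using k_pos by (simp add: g_def x_eq j(2))
qed

end

subsection \<open>Existence\<close>

lemma SUEB_of_indexed_family:
  assumes "finite I" "card I < d * e"
    and special: "\<And>i. i \<in> I \<Longrightarrow> special_entangled d e k (\<Psi> i)"
    and orthonormal: "\<And>i j. i \<in> I \<Longrightarrow> j \<in> I \<Longrightarrow> braket (\<Psi> i) (\<Psi> j) = (if i = j then 1 else 0)"
    and unextendible: "\<And>\<phi>. special_entangled d e k \<phi> \<Longrightarrow> \<exists>i\<in>I. braket (\<Psi> i) \<phi> \<noteq> 0"
  shows "\<exists>\<psi>. SUEB d e k (card I) \<psi>"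
proof -
  obtain h where bij: "bij_betw h {1..card I} I"
    using ex_bij_betw_nat_finite_1[OF assms(1)] by blast
  have mem: "h i \<in> I" if "i \<in> {1..card I}" for i
    using bij_betwE[OF bij] that by blast
  have "\<not> special_entangled d e k \<phi>" if "\<forall>i\<in>{1..card I}. braket (\<Psi> (h i)) \<phi> = 0" for \<phi>
    using that unextendible[of \<phi>] bij_betw_ball[OF bij, of "\<lambda>i. braket (\<Psi> i) \<phi> = 0"] by blast
  moreover have "braket (\<Psi> (h i)) (\<Psi> (h j)) = (if i = j then 1 else 0)"
    if "i \<in> {1..card I}" "j \<in> {1..card I}" for i j
    using orthonormal[OF mem mem] inj_on_eq_iff[OF bij_betw_imp_inj_on[OF bij]] that by simp
  ultimately have "SUEB d e k (card I) (\<lambda>i. \<Psi> (h i))"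
    using assms(2) special[OF mem] by (simp add: SUEB_def)
  then show ?thesis
    by blast
qed

lemma SUEB_exists:
  assumes "s * k \<le> d" "k \<le> q" "q \<le> e" "(d - s * k) + (e - q) < k" "s * k * q < d * e"
  shows "\<exists>\<psi>. SUEB d e k (s * k * q) \<psi>"
proof -
  interpret fourier_block d e k s q
    using assms by unfold_locales auto
  have "\<exists>i\<in>fourier_index. braket (fourier_state i) \<phi> \<noteq> 0"
    if special: "special_entangled d e k \<phi>" for \<phi>
  proof (rule ccontr)
    assume "\<not> ?thesis"
    moreover have "\<phi> \<in> carrier_vec (d * e)"
      using special by (simp add: special_entangled_def pure_state_def)
    ultimately have "\<phi> $ (x * e + y) = 0" if "x < s * k" "y < q" for x y
      using that by (intro zero_block_if_orthogonal_to_fourier_states) auto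
    then have "k \<le> (d - s * k) + (e - q)"
      using special_entangled_zero_block[OF special assms(1,3)] by blast
    then show False
      using assms(4) by simp
  qed
  moreover have "finite fourier_index" "card fourier_index = s * k * q"
    by (simp_all add: fourier_index_def card_cartesian_product)
  ultimately show ?thesis
    using SUEB_of_indexed_family[of fourier_index d e k fourier_state] assms(5)
      special_entangled_fourier_state braket_fourier_states by simp
qed

lemma SUEB_exists_quotient_remainder:
  assumes "d = s * k + r" "k \<le> e - t" "r + t < k" "0 < r + t" "0 < d"
  shows "\<exists>\<psi>. SUEB d e k (s * k * (e - t)) \<psi>" "\<exists>\<psi>. SUEB e d k (s * k * (e - t)) \<psi>"
proof -
  have "t < e"
    using assms by simp
  have "s * k * (e - t) < d * e"
  proof (cases "r = 0")
    case True
    then show ?thesis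
      using assms \<open>t < e\<close> by simp
  next
    case False
    have "s * k * (e - t) \<le> s * k * e"
      by simp
    also have "\<dots> < d * e"
      using False assms \<open>t < e\<close> by simp
    finally show ?thesis .
  qed
  then show "\<exists>\<psi>. SUEB d e k (s * k * (e - t)) \<psi>"
    using assms \<open>t < e\<close> by (intro SUEB_exists) auto
  then show "\<exists>\<psi>. SUEB e d k (s * k * (e - t)) \<psi>"
    using SUEB_swap_vec by blast
qed

lemma SUEB_exists_dvd:
  assumes "k dvd d" "k \<le> e - t" "0 < t" "t < k" "0 < d"
  shows "\<exists>\<psi>. SUEB d e k (d * (e - t)) \<psi>" "\<exists>\<psi>. SUEB e d k (d * (e - t)) \<psi>"
  using SUEB_exists_quotient_remainder[of d "d div k" k 0 e t] assms by simp_all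

theorem theorem3p1:
  fixes k d d' :: nat
  assumes "(2 \<le> k \<and> k < d \<and> d \<le> d') \<or> (2 \<le> k \<and> k = d \<and> d < d')"
  shows "(k dvd d \<longrightarrow>
            (\<forall>i\<in>{1..k - 1}. d' - i \<ge> k \<longrightarrow> (\<exists>\<psi>. SUEB d d' k (d * (d' - i)) \<psi>)))
       \<and> (\<not> k dvd d \<longrightarrow>
            (\<forall>s r. d = s * k + r \<and> 0 < r \<and> r < k \<longrightarrow>
              (\<forall>t\<in>{0..k - r - 1}. d' - t \<ge> k \<longrightarrow> (\<exists>\<psi>. SUEB d d' k (s * k * (d' - t)) \<psi>))))
       \<and> (k dvd d' \<longrightarrow>
            (\<forall>i\<in>{1..k - 1}. d - i \<ge> k \<longrightarrow> (\<exists>\<psi>. SUEB d d' k (d' * (d - i)) \<psi>)))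
       \<and> (\<not> k dvd d' \<longrightarrow>
            (\<forall>s r. d' = s * k + r \<and> 0 < r \<and> r < k \<longrightarrow>
              (\<forall>t\<in>{0..k - r - 1}. d - t \<ge> k \<longrightarrow> (\<exists>\<psi>. SUEB d d' k (s * k * (d - t)) \<psi>))))"
proof (intro conjI impI ballI allI)
  have pos: "0 < d" "0 < d'"
    using assms by auto
  {
    fix i assume "k dvd d" "i \<in> {1..k - 1}" "d' - i \<ge> k"
    then show "\<exists>\<psi>. SUEB d d' k (d * (d' - i)) \<psi>"
      using pos by (intro SUEB_exists_dvd(1)) auto
  next
    fix s r t assume "d = s * k + r \<and> 0 < r \<and> r < k" "t \<in> {0..k - r - 1}" "d' - t \<ge> k"
    then show "\<exists>\<psi>. SUEB d d' k (s * k * (d' - t)) \<psi>"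
      using pos by (intro SUEB_exists_quotient_remainder(1)) auto
  next
    fix i assume "k dvd d'" "i \<in> {1..k - 1}" "d - i \<ge> k"
    then show "\<exists>\<psi>. SUEB d d' k (d' * (d - i)) \<psi>"
      using pos by (intro SUEB_exists_dvd(2)) auto
  next
    fix s r t assume "d' = s * k + r \<and> 0 < r \<and> r < k" "t \<in> {0..k - r - 1}" "d - t \<ge> k"
    then show "\<exists>\<psi>. SUEB d d' k (s * k * (d - t)) \<psi>"
      using pos by (intro SUEB_exists_quotient_remainder(2)) auto
  }
qed

end
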